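(* Let $X$ be a simplicial $m$-complex with $m>0$. (1) Let $\phi\in C_m(\mathbb{Z}_2)$ minimize the quotient in $$h_m=\min_{\substack{\phi\in C_m(\mathbb{Z}_2)\\ \phi\notin \operatorname{im}\partial}}\frac{\lVert\partial\phi\rVert}{\min_{\psi\in\operatorname{im}\partial}\lVert\phi+\psi\rVert}.$$ If all the $m$-simplexes in $\phi$ can be similarly oriented, then $h_m\ge\lambda_m$. (2) Assume that every $(m-1)$-dimensional simplex of $X$ is incident to (i.e. contained in) at most two $m$-simplexes of $X$. Then $$\lambda_m\ \ge\ \frac{h_m^2}{2(m+1)}.$$
   Context: A simplicial complex is a finite abstract simplicial complex (a finite collection of nonempty finite vertex sets, called simplexes, closed under taking nonempty subsets). A $k$-simplex has $k+1$ vertices; $S_k=S_k(X)$ is the set of $k$-simplexes of $X$. A simplicial $m$-complex is one with $S_m\neq\emptyset$ and $S_{m+1}=\emptyset$. If $\sigma\in S_k$, $\tau\in S_{k+1}$ and $\sigma\subset\tau$, then $\sigma$ is a face of $\tau$ and $\tau$ a coface of $\sigma$. Two distinct $k$-simplexes are lower adjacent if they share a common face. For a field $F$, $C_k(F)=C_k(X;F)$ is the space of (oriented) simplicial $k$-chains with coefficients in $F$ (the two orientations of a simplex are negatives of each other; $C_k(F)=0$ if $k<0$ or $k>m$), and $\partial=\partial_k:C_k(F)\to C_{k-1}(F)$ is the usual simplicial boundary map $\partial[v_0,\dots,v_k]=\sum_i(-1)^i[v_0,\dots,v_{i-1},v_{i+1},\dots,v_k]$. In quotients involving $C_k(F)$,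 $\operatorname{im}\partial$ means $\operatorname{im}\partial_{k+1}\subseteq C_k(F)$; in particular for $k=m$ it is $\{0\}$. A chain over $\mathbb{Z}_2$ is identified with the set of simplexes to which it assigns coefficient $1$, and $\lVert\cdot\rVert$ on chains over $\mathbb{Z}_2$ is the Hamming norm (the number of simplexes in that set). The $k$-th boundary Cheeger number is $h_k=\min_{\phi\in C_k(\mathbb{Z}_2),\,\phi\notin\operatorname{im}\partial}\dfrac{\lVert\partial\phi\rVert}{\min_{\psi\in\operatorname{im}\partial}\lVert\phi+\psi\rVert}$. With $\lVert\cdot\rVert_2$ the Euclidean norm on real chains (with the $k$-simplexes, each given one orientation, as an orthonormal basis), $\lambda_k=\min_{f\in C_k(\mathbb{R}),\,f\notin\operatorname{im}\partial}\dfrac{\lVert\partial f\rVert_2^2}{\min_{g\in\operatorname{im}\partial}\lVert f+g\rVert_2^2}$. Two oriented lower adjacent $k$-simplexes $\sigma,\tau$ with common face $\{u_0,\dots,u_{k-1}\}$ are dissimilarly oriented if $\partial\sigma$ and $\partial\tau$ (over $\mathbb{R}$) assign the same coefficient ($+1$ or $-1$) to the oriented simplex $[u_0,\dots,u_{k-1}]$; otherwise they are similarly oriented. A set of $k$-simplexes can be similarly oriented if orientations can be chosen for all of them such that every two lower adjacent ones in the set are similarly oriented. *)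

theory Defs
  imports
    Complex_Main
    "HOL-Library.Z2"
    "HOL-Combinatorics.Permutations"
    "HOL-Analysis.L2_Norm"
begin

definition simplicial_complex :: "'a set set \<Rightarrow> bool" where
  "simplicial_complex X \<longleftrightarrow>
     finite X \<and> (\<forall>\<sigma>\<in>X. finite \<sigma> \<and> \<sigma> \<noteq> {}) \<and>
     (\<forall>\<sigma>\<in>X. \<forall>\<tau>. \<tau> \<subseteq> \<sigma> \<and> \<tau> \<noteq> {} \<longrightarrow> \<tau> \<in> X)"

definition simplexes :: "'a set set \<Rightarrow> nat \<Rightarrow> 'a set set" where
  "simplexes X k = {\<sigma> \<in> X. card \<sigma> = k + 1}"

definition simplicial_m_complex :: "'a set set \<Rightarrow> nat \<Rightarrow> bool" where
  "simplicial_m_complex X m \<longleftrightarrow>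
     simplicial_complex X \<and> simplexes X m \<noteq> {} \<and> simplexes X (m + 1) = {}"

definition is_face :: "'a set set \<Rightarrow> 'a set \<Rightarrow> 'a set \<Rightarrow> bool" where
  "is_face X \<sigma> \<tau> \<longleftrightarrow> (\<exists>k. \<sigma> \<in> simplexes X k \<and> \<tau> \<in> simplexes X (k + 1)) \<and> \<sigma> \<subset> \<tau>"

definition lower_adjacent :: "'a set set \<Rightarrow> 'a set \<Rightarrow> 'a set \<Rightarrow> bool" where
  "lower_adjacent X \<sigma> \<tau> \<longleftrightarrow> \<sigma> \<noteq> \<tau> \<and> (\<exists>\<rho>. is_face X \<rho> \<sigma> \<and> is_face X \<rho> \<tau>)"

text \<open>
  An oriented \<open>k\<close>-chain is an alternating function on orderings \<open>[v0, ..., vk]\<close> of the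
  \<open>k\<close>-simplexes: \<open>c xs\<close> is the coefficient of \<open>c\<close> at the oriented simplex \<open>[xs]\<close>.
  Reordering the vertices multiplies it by the sign of the permutation.
\<close>

definition simplicial_chains :: "'a set set \<Rightarrow> nat \<Rightarrow> ('a list \<Rightarrow> 'f::field) set" where
  "simplicial_chains X k = {c. (\<forall>xs. c xs \<noteq> 0 \<longrightarrow> distinct xs \<and> set xs \<in> simplexes X k) \<and>
     (\<forall>xs p. p permutes {..<length xs} \<longrightarrow> c (permute_list p xs) = of_int (sign p) * c xs)}"

text \<open>
  The elementary chain \<open>[v0, ..., vk]\<close>.  If the vertices are distinct, at most one
  permutation contributes to the sum.  The empty list is not a simplex (\<open>C\<close> in degree
  \<open>-1\<close> is zero), so the boundary of a vertex vanishes.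
\<close>

definition oriented_simplex :: "'a list \<Rightarrow> 'a list \<Rightarrow> 'f::field" where
  "oriented_simplex xs ys =
     (if xs = [] then 0
      else \<Sum>p | p permutes {..<length xs} \<and> permute_list p xs = ys. of_int (sign p))"

definition boundary_simplex :: "'a list \<Rightarrow> 'a list \<Rightarrow> 'f::field" where
  "boundary_simplex xs ys =
     (\<Sum>i<length xs. (-1) ^ i * oriented_simplex (take i xs @ drop (Suc i) xs) ys)"

definition reference_order :: "'a set \<Rightarrow> 'a list" where
  "reference_order \<sigma> = (SOME xs. distinct xs \<and> set xs = \<sigma>)"

text \<open>
  Linear extension of \<open>boundary_simplex\<close>, using that a chain \<open>c\<close> is the sum over the simplexes
  \<open>\<sigma>\<close> of \<open>c xs\<close> times the elementary chain \<open>[xs]\<close>, for any one ordering \<open>xs\<close> of \<open>\<sigma>\<close>.  The value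
  does not depend on the orderings, because a reordering changes the sign of both factors.
\<close>

definition boundary :: "'a set set \<Rightarrow> ('a list \<Rightarrow> 'f::field) \<Rightarrow> 'a list \<Rightarrow> 'f" where
  "boundary X c ys =
     (\<Sum>\<sigma>\<in>X. c (reference_order \<sigma>) * boundary_simplex (reference_order \<sigma>) ys)"

text \<open>The image of the boundary map in degree \<open>k\<close>, i.e. of the map from degree \<open>k + 1\<close>.\<close>

definition boundaries :: "'a set set \<Rightarrow> nat \<Rightarrow> ('a list \<Rightarrow> 'f::field) set" where
  "boundaries X k = boundary X ` simplicial_chains X (k + 1)"

definition simplexes_of :: "('a list \<Rightarrow> bit) \<Rightarrow> 'a set set" where
  "simplexes_of \<phi> = {set xs | xs. \<phi> xs = 1}"

definition hamming_norm :: "('a list \<Rightarrow> bit) \<Rightarrow> nat" where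
  "hamming_norm \<phi> = card (simplexes_of \<phi>)"

definition cheeger_quotient :: "'a set set \<Rightarrow> nat \<Rightarrow> ('a list \<Rightarrow> bit) \<Rightarrow> real" where
  "cheeger_quotient X k \<phi> =
     real (hamming_norm (boundary X \<phi>)) /
     real (Min ((\<lambda>\<psi>. hamming_norm (\<lambda>xs. \<phi> xs + \<psi> xs)) ` boundaries X k))"

definition cheeger_number :: "'a set set \<Rightarrow> nat \<Rightarrow> real" where
  "cheeger_number X k = Min (cheeger_quotient X k ` (simplicial_chains X k - boundaries X k))"

definition euclidean_norm :: "'a set set \<Rightarrow> ('a list \<Rightarrow> real) \<Rightarrow> real" where
  "euclidean_norm X f = L2_set (\<lambda>\<sigma>. f (reference_order \<sigma>)) X"

text \<open>
  In the two real definitions the minima range over infinite sets.  Both are attained (a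
  distance to a subspace; a Rayleigh quotient in finite dimension), so the infimum is the
  minimum as soon as some chain is not a boundary.
\<close>

definition rayleigh_quotient :: "'a set set \<Rightarrow> nat \<Rightarrow> ('a list \<Rightarrow> real) \<Rightarrow> real" where
  "rayleigh_quotient X k f =
     (euclidean_norm X (boundary X f))\<^sup>2 /
     (INF g\<in>boundaries X k. (euclidean_norm X (\<lambda>xs. f xs + g xs))\<^sup>2)"

definition spectral_gap :: "'a set set \<Rightarrow> nat \<Rightarrow> real" where
  "spectral_gap X k = (INF f\<in>simplicial_chains X k - boundaries X k. rayleigh_quotient X k f)"

text \<open>
  For lower adjacent simplexes oriented by the vertex orderings \<open>xs\<close> and \<open>ys\<close>.  Whether the two
  coefficients at the common face agree does not depend on the ordering \<open>us\<close> of that face.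
\<close>

definition dissimilarly_oriented :: "'a set set \<Rightarrow> 'a list \<Rightarrow> 'a list \<Rightarrow> bool" where
  "dissimilarly_oriented X xs ys \<longleftrightarrow>
     (\<exists>us. distinct us \<and> is_face X (set us) (set xs) \<and> is_face X (set us) (set ys) \<and>
        boundary X (oriented_simplex xs) us = (boundary X (oriented_simplex ys) us :: real))"

definition can_be_similarly_oriented :: "'a set set \<Rightarrow> 'a set set \<Rightarrow> bool" where
  "can_be_similarly_oriented X A \<longleftrightarrow>
     (\<exists>ord. (\<forall>\<sigma>\<in>A. distinct (ord \<sigma>) \<and> set (ord \<sigma>) = \<sigma>) \<and>
        (\<forall>\<sigma>\<in>A. \<forall>\<tau>\<in>A. lower_adjacent X \<sigma> \<tau> \<longrightarrow>
           \<not> dissimilarly_oriented X (ord \<sigma>) (ord \<tau>)))"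

end

theory Submission
  imports Defs
begin

text \<open>
  In top dimension \<open>m\<close> the only boundary is \<open>0\<close>, so \<open>h\<close> is the least ratio \<open>\<parallel>\<partial>\<phi>\<parallel> / \<parallel>\<phi>\<parallel>\<close> over nonzero
  chains modulo 2, and \<open>\<lambda>\<close> the least ratio \<open>\<parallel>\<partial>f\<parallel>\<^sup>2 / \<parallel>f\<parallel>\<^sup>2\<close> over nonzero real chains. A chain modulo 2 is
  a set \<open>A\<close> of \<open>m\<close>-simplexes, and its boundary is the set of those \<open>(m - 1)\<close>-simplexes that lie in an
  odd number of members of \<open>A\<close> (\<open>simplexes_of_boundary\<close>).

  For the upper bound, orient a minimizing set \<open>A\<close> similarly and let \<open>f\<close> be the sum of its oriented
  simplexes. At a face, the members of \<open>A\<close> that contain it contribute coefficients \<open>1\<close> or \<open>- 1\<close> to \<open>\<partial>f\<close>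
  which are pairwise different. Hence there are at most two of them, two cancel, and a single one
  contributes a unit. So \<open>\<parallel>\<partial>f\<parallel>\<^sup>2\<close> is the number of faces in the boundary of \<open>A\<close>, while \<open>\<parallel>f\<parallel>\<^sup>2\<close> is the
  number of members of \<open>A\<close> (\<open>similarly_oriented_real_chain\<close>). The Rayleigh quotient of \<open>f\<close> therefore
  equals \<open>h\<close>.

  The lower bound is Cheeger's argument with \<open>(m - 1)\<close>-simplexes in the role of edges. If each of them
  has at most two cofaces, \<open>\<bar>\<partial>f\<bar>\<close> at a face dominates the difference of the values of \<open>\<bar>f\<bar>\<close> at its cofaces,
  where a missing second coface counts as a simplex of value \<open>0\<close> (\<open>coface_variation_le_boundary\<close>). A
  coarea argument over the superlevel sets of \<open>f\<^sup>2\<close> bounds the total variation of \<open>f\<^sup>2\<close> from below by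
  \<open>h * \<parallel>f\<parallel>\<^sup>2\<close> (\<open>isoperimetric_weights\<close>), and the Cauchy-Schwarz inequality bounds its square from above
  by \<open>\<parallel>\<partial>f\<parallel>\<^sup>2 * 2 * (m + 1) * \<parallel>f\<parallel>\<^sup>2\<close>, as an \<open>m\<close>-simplex has \<open>m + 1\<close> faces (\<open>weighted_cheeger_inequality\<close>).
\<close>

section \<open>Incidence coefficients of the boundary map\<close>

lemma permute_list_inj:
  assumes "distinct xs" and p: "p permutes {..<length xs}" and q: "q permutes {..<length xs}"
    and eq: "permute_list p xs = permute_list q xs"
  shows "p = q"
proof
  fix i
  show "p i = q i"
  proof (cases "i < length xs")
    case True
    have "xs ! p i = xs ! q i"
      using permute_list_nth[OF p True] permute_list_nth[OF q True] eq by simp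
    moreover have "p i < length xs" "q i < length xs"
      using permutes_in_image[OF p, of i] permutes_in_image[OF q, of i] True by auto
    ultimately show ?thesis
      using \<open>distinct xs\<close> nth_eq_iff_index_eq by blast
  next
    case False
    then show ?thesis
      using permutes_not_in[OF p, of i] permutes_not_in[OF q, of i] by simp
  qed
qed

lemma distinct_lists_permutation:
  assumes "distinct xs" "distinct ys" "set xs = set ys"
  obtains p where "p permutes {..<length xs}" "permute_list p xs = ys"
proof -
  have "mset ys = mset xs"
    using assms set_eq_iff_mset_eq_distinct by metis
  then show ?thesis
    using that by (rule mset_eq_permutation)
qed

lemma of_int_sign_cases: "of_int (sign p) \<in> {1, - 1 :: 'f::field}"
  by (cases p rule: sign_cases) auto

lemma oriented_simplex_permute:
  assumes "distinct xs" "xs \<noteq> []" and p: "p permutes {..<length xs}"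
  shows "oriented_simplex xs (permute_list p xs) = (of_int (sign p) :: 'f::field)"
proof -
  have "{q. q permutes {..<length xs} \<and> permute_list q xs = permute_list p xs} = {p}"
    using permute_list_inj[OF \<open>distinct xs\<close> _ p] p by blast
  then show ?thesis
    using \<open>xs \<noteq> []\<close> by (simp add: oriented_simplex_def)
qed

lemma oriented_simplex_unit:
  assumes "distinct xs" "xs \<noteq> []" "distinct ys" "set ys = set xs"
  shows "oriented_simplex xs ys \<in> {1, - 1 :: 'f::field}"
proof -
  obtain p where "p permutes {..<length xs}" "permute_list p xs = ys"
    using distinct_lists_permutation[of xs ys] assms by metis
  then show ?thesis
    using oriented_simplex_permute[OF assms(1,2), of p, where ?'f = 'f]
      of_int_sign_cases[of p, where ?'f = 'f] by simp
qed

lemma oriented_simplex_eq_0: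
  assumes "distinct xs" "\<not> (distinct ys \<and> set ys = set xs)"
  shows "oriented_simplex xs ys = (0 :: 'f::field)"
proof -
  have "{p. p permutes {..<length xs} \<and> permute_list p xs = ys} = {}"
    using assms by auto
  then show ?thesis
    by (simp only: oriented_simplex_def) simp
qed

lemma oriented_simplex_alternating:
  assumes q: "q permutes {..<length ys}"
  shows "oriented_simplex xs (permute_list q ys) = of_int (sign q) * (oriented_simplex xs ys :: 'f::field)"
proof (cases "length xs = length ys \<and> xs \<noteq> []")
  case False
  then have "{p. p permutes {..<length xs} \<and> permute_list p xs = permute_list q ys} = {} \<or> xs = []"
    and "{p. p permutes {..<length xs} \<and> permute_list p xs = ys} = {} \<or> xs = []"
    by (metis (mono_tags, lifting) Collect_empty_eq length_permute_list)+
  then show ?thesis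
    by (auto simp: oriented_simplex_def simp del: Collect_empty_eq)
next
  case True
  then have q': "q permutes {..<length xs}" and len: "length xs = length ys" and ne: "xs \<noteq> []"
    using q by auto
  have inv_q: "inv q permutes {..<length xs}"
    using q' by (rule permutes_inv)
  have "(\<Sum>p | p permutes {..<length xs} \<and> permute_list p xs = permute_list q ys. of_int (sign p))
      = (\<Sum>p | p permutes {..<length xs} \<and> permute_list p xs = ys. of_int (sign (p \<circ> q)) :: 'f)"
  proof (rule sum.reindex_bij_witness[of _ "\<lambda>p. p \<circ> q" "\<lambda>p. p \<circ> inv q"])
    fix p assume "p \<in> {p. p permutes {..<length xs} \<and> permute_list p xs = permute_list q ys}"
    then have p: "p permutes {..<length xs}" and eq: "permute_list p xs = permute_list q ys"
      by auto
    show "p \<circ> inv q \<circ> q = p"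
      using permutes_inv_o(2)[OF q'] by (simp add: comp_assoc)
    have "permute_list (p \<circ> inv q) xs = permute_list (inv q) (permute_list q ys)"
      using permute_list_compose[OF inv_q] eq by simp
    also have "\<dots> = permute_list (q \<circ> inv q) ys"
      using permute_list_compose[of "inv q" ys q] inv_q len by simp
    also have "\<dots> = ys"
      using permutes_inv_o(1)[OF q'] by simp
    finally show "p \<circ> inv q \<in> {p. p permutes {..<length xs} \<and> permute_list p xs = ys}"
      using permutes_compose[OF inv_q p] by simp
    show "of_int (sign (p \<circ> inv q \<circ> q)) = (of_int (sign p) :: 'f)"
      using permutes_inv_o(2)[OF q'] by (simp add: comp_assoc)
  next
    fix p assume "p \<in> {p. p permutes {..<length xs} \<and> permute_list p xs = ys}"
    then have p: "p permutes {..<length xs}" and eq: "permute_list p xs = ys"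
      by auto
    show "p \<circ> q \<circ> inv q = p"
      using permutes_inv_o(1)[OF q'] by (simp add: comp_assoc)
    show "p \<circ> q \<in> {p. p permutes {..<length xs} \<and> permute_list p xs = permute_list q ys}"
      using permute_list_compose[OF q'] eq permutes_compose[OF q' p] by simp
  qed
  also have "\<dots> = (\<Sum>p | p permutes {..<length xs} \<and> permute_list p xs = ys.
                    of_int (sign q) * of_int (sign p))"
  proof (intro sum.cong refl)
    fix p assume "p \<in> {p. p permutes {..<length xs} \<and> permute_list p xs = ys}"
    then have "sign (p \<circ> q) = sign p * sign q"
      using q' by (intro sign_compose) (auto intro: permutes_imp_permutation[of "{..<length xs}"])
    then show "of_int (sign (p \<circ> q)) = of_int (sign q) * (of_int (sign p) :: 'f)"
      by simp
  qed
  finally show ?thesis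
    using ne by (simp add: oriented_simplex_def sum_distrib_left)
qed

lemma omit_nth:
  assumes "distinct xs" "i < length xs"
  shows "distinct (take i xs @ drop (Suc i) xs)"
    and "set (take i xs @ drop (Suc i) xs) = set xs - {xs ! i}"
proof -
  have "xs = take i xs @ xs ! i # drop (Suc i) xs"
    using assms(2) by (rule id_take_nth_drop)
  then have "distinct (take i xs @ xs ! i # drop (Suc i) xs)"
    and "set xs = set (take i xs @ xs ! i # drop (Suc i) xs)"
    using assms(1) by (metis, metis)
  then show "distinct (take i xs @ drop (Suc i) xs)"
    and "set (take i xs @ drop (Suc i) xs) = set xs - {xs ! i}"
    by auto
qed

text \<open>
  Only the term of the alternating sum that omits the one vertex outside \<open>set ys\<close> can be nonzero.
\<close>

lemma boundary_simplex_unit: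
  assumes xs: "distinct xs" and ys: "distinct ys" "ys \<noteq> []"
    and sub: "set ys \<subset> set xs" "length xs = Suc (length ys)"
  shows "boundary_simplex xs ys \<in> {1, - 1 :: 'f::field}"
proof -
  have "card (set xs - set ys) = 1"
    using xs ys sub by (simp add: card_Diff_subset distinct_card)
  then obtain v where v: "set xs - set ys = {v}"
    using card_1_singletonE by blast
  then obtain i where i: "i < length xs" "xs ! i = v"
    by (metis Diff_iff in_set_conv_nth insertI1)
  have other: "oriented_simplex (take j xs @ drop (Suc j) xs) ys = (0 :: 'f)"
    if "j < length xs" "j \<noteq> i" for j
  proof (rule oriented_simplex_eq_0[OF omit_nth(1)[OF xs that(1)]])
    have "xs ! j \<noteq> v"
      using that i xs nth_eq_iff_index_eq by blast
    then have "xs ! j \<in> set ys"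
      using v that(1) nth_mem by blast
    then show "\<not> (distinct ys \<and> set ys = set (take j xs @ drop (Suc j) xs))"
      using omit_nth(2)[OF xs that(1)] by blast
  qed
  have "boundary_simplex xs ys
      = (\<Sum>j\<in>{i}. (- 1) ^ j * oriented_simplex (take j xs @ drop (Suc j) xs) ys :: 'f)"
    unfolding boundary_simplex_def using i(1) other by (intro sum.mono_neutral_right) auto
  then have eq: "boundary_simplex xs ys
      = (- 1) ^ i * (oriented_simplex (take i xs @ drop (Suc i) xs) ys :: 'f)"
    by simp
  have set_i: "set ys = set (take i xs @ drop (Suc i) xs)"
    using omit_nth(2)[OF xs i(1)] i(2) v sub(1) by blast
  then have "take i xs @ drop (Suc i) xs \<noteq> []"
    using ys(2) by (metis set_empty)
  then have "oriented_simplex (take i xs @ drop (Suc i) xs) ys \<in> {1, - 1 :: 'f}"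
    by (intro oriented_simplex_unit omit_nth(1)[OF xs i(1)] ys(1) set_i)
  then show ?thesis
    unfolding eq by (cases "even i") auto
qed

lemma boundary_simplex_eq_0:
  assumes xs: "distinct xs"
    and "\<not> (distinct ys \<and> set ys \<subset> set xs \<and> length xs = Suc (length ys))"
  shows "boundary_simplex xs ys = (0 :: 'f::field)"
  unfolding boundary_simplex_def
proof (intro sum.neutral ballI)
  fix i assume "i \<in> {..<length xs}"
  then have i: "i < length xs" by simp
  have "\<not> (distinct ys \<and> set ys = set (take i xs @ drop (Suc i) xs))"
  proof
    assume *: "distinct ys \<and> set ys = set (take i xs @ drop (Suc i) xs)"
    then have "length ys = length (take i xs @ drop (Suc i) xs)"
      using omit_nth(1)[OF xs i] by (metis distinct_card)
    then have "length xs = Suc (length ys)" using i by simp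
    moreover have "set ys \<subset> set xs"
      using * omit_nth(2)[OF xs i] i nth_mem by blast
    ultimately show False using * assms(2) by blast
  qed
  then show "(- 1) ^ i * oriented_simplex (take i xs @ drop (Suc i) xs) ys = (0 :: 'f)"
    using oriented_simplex_eq_0[OF omit_nth(1)[OF xs i]] by simp
qed

section \<open>Chains in terms of simplexes\<close>

lemma reference_order:
  assumes "finite \<sigma>"
  shows "distinct (reference_order \<sigma>)" "set (reference_order \<sigma>) = \<sigma>"
proof -
  have "\<exists>xs. distinct xs \<and> set xs = \<sigma>"
    using finite_distinct_list[OF assms] by blast
  then have "distinct (reference_order \<sigma>) \<and> set (reference_order \<sigma>) = \<sigma>"
    unfolding reference_order_def by (rule someI_ex)
  then show "distinct (reference_order \<sigma>)" "set (reference_order \<sigma>) = \<sigma>" by auto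
qed

lemma simplexes_finite:
  assumes "simplicial_complex X"
  shows "finite X" and "finite (simplexes X k)"
    and "\<sigma> \<in> X \<Longrightarrow> finite \<sigma>" and "\<sigma> \<in> simplexes X k \<Longrightarrow> finite \<sigma>"
  using assms by (auto simp: simplicial_complex_def simplexes_def)

lemma chain_eq_0:
  assumes "c \<in> simplicial_chains X k" "\<not> (distinct xs \<and> set xs \<in> simplexes X k)"
  shows "c xs = 0"
  using assms unfolding simplicial_chains_def by blast

lemma chain_alternating:
  assumes "c \<in> simplicial_chains X k" "p permutes {..<length xs}"
  shows "c (permute_list p xs) = of_int (sign p) * c xs"
  using assms unfolding simplicial_chains_def by blast

text \<open>
  Only signs depend on the ordering, so vanishing is a property of the simplex; the same holds for
  the values of a chain modulo 2.
\<close>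

lemma chain_eq_0_reorder:
  assumes "c \<in> simplicial_chains X k" "distinct xs" "distinct ys" "set xs = set ys"
  shows "c xs = 0 \<longleftrightarrow> c ys = 0"
proof -
  obtain p where "p permutes {..<length xs}" "permute_list p xs = ys"
    using distinct_lists_permutation[OF assms(2-4)] by metis
  then have "c ys = of_int (sign p) * c xs"
    using chain_alternating[OF assms(1)] by metis
  then show ?thesis
    by (cases p rule: sign_cases) auto
qed

text \<open>
  All other simplexes drop out, as the chain lives in degree \<open>k + 1\<close> and the incidence coefficient is
  \<open>0\<close> off the cofaces. On the cofaces it is a unit (lemma \<open>incidence_unit\<close> below), so this turns the
  boundary map into a signed incidence sum over sets.
\<close>

lemma boundary_eq_sum_cofaces:
  assumes X: "simplicial_complex X" and c: "c \<in> simplicial_chains X (k + 1)"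
    and ys: "distinct ys" "length ys = k + 1"
  shows "boundary X c ys = (\<Sum>\<sigma>\<in>{\<sigma> \<in> simplexes X (k + 1). set ys \<subset> \<sigma>}.
           c (reference_order \<sigma>) * boundary_simplex (reference_order \<sigma>) ys)"
  unfolding boundary_def
proof (rule sum.mono_neutral_right)
  show "\<forall>\<sigma>\<in>X - {\<sigma> \<in> simplexes X (k + 1). set ys \<subset> \<sigma>}.
      c (reference_order \<sigma>) * boundary_simplex (reference_order \<sigma>) ys = 0"
  proof
    fix \<sigma> assume \<sigma>: "\<sigma> \<in> X - {\<sigma> \<in> simplexes X (k + 1). set ys \<subset> \<sigma>}"
    then have ref: "distinct (reference_order \<sigma>)" "set (reference_order \<sigma>) = \<sigma>"
      using reference_order[OF simplexes_finite(3)[OF X]] by blast+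
    show "c (reference_order \<sigma>) * boundary_simplex (reference_order \<sigma>) ys = 0"
    proof (cases "\<sigma> \<in> simplexes X (k + 1)")
      case True
      then have "\<not> set ys \<subset> set (reference_order \<sigma>)" using \<sigma> ref by auto
      then show ?thesis using boundary_simplex_eq_0[OF ref(1)] by auto
    next
      case False
      then show ?thesis using chain_eq_0[OF c] ref by auto
    qed
  qed
qed (use simplexes_finite(1)[OF X] in \<open>auto simp: simplexes_def\<close>)

lemma boundary_eq_0:
  assumes X: "simplicial_complex X" and c: "c \<in> simplicial_chains X (k + 1)"
    and ys: "\<not> (distinct ys \<and> length ys = k + 1)"
  shows "boundary X c ys = 0"
  unfolding boundary_def
proof (intro sum.neutral ballI)
  fix \<sigma> assume \<sigma>: "\<sigma> \<in> X"
  then have ref: "distinct (reference_order \<sigma>)" "set (reference_order \<sigma>) = \<sigma>"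
    using reference_order[OF simplexes_finite(3)[OF X]] by blast+
  show "c (reference_order \<sigma>) * boundary_simplex (reference_order \<sigma>) ys = 0"
  proof (cases "\<sigma> \<in> simplexes X (k + 1)")
    case True
    then have "length (reference_order \<sigma>) = Suc (k + 1)"
      using ref distinct_card[OF ref(1)] by (simp add: simplexes_def)
    then show ?thesis using boundary_simplex_eq_0[OF ref(1)] ys by auto
  next
    case False
    then show ?thesis using chain_eq_0[OF c] ref by auto
  qed
qed

lemma incidence_unit:
  assumes X: "simplicial_complex X" and \<sigma>: "\<sigma> \<in> simplexes X (k + 1)"
    and ys: "distinct ys" "length ys = k + 1" "set ys \<subset> \<sigma>"
  shows "boundary_simplex (reference_order \<sigma>) ys \<in> {1, - 1 :: 'f::field}"
proof -
  have ref: "distinct (reference_order \<sigma>)" "set (reference_order \<sigma>) = \<sigma>"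
    using reference_order[OF simplexes_finite(4)[OF X \<sigma>]] by auto
  then have "length (reference_order \<sigma>) = Suc (length ys)"
    using \<sigma> ys distinct_card[OF ref(1)] by (simp add: simplexes_def)
  moreover have "ys \<noteq> []" using ys(2) by auto
  ultimately show ?thesis
    using boundary_simplex_unit[OF ref(1) ys(1), where ?'f = 'f] ref(2) ys(3) by simp
qed

lemma reference_order_simplexes:
  assumes X: "simplicial_complex X" and "\<sigma> \<in> simplexes X k"
  shows "distinct (reference_order \<sigma>)" "set (reference_order \<sigma>) = \<sigma>" "length (reference_order \<sigma>) = k + 1"
proof -
  show ref: "distinct (reference_order \<sigma>)" "set (reference_order \<sigma>) = \<sigma>"
    using reference_order[OF simplexes_finite(4)[OF assms]] by auto
  then show "length (reference_order \<sigma>) = k + 1"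
    using assms(2) distinct_card[OF ref(1)] by (simp add: simplexes_def)
qed

lemma face_simplexes:
  assumes "simplicial_complex X" "\<sigma> \<in> simplexes X (k + 1)" "\<tau> \<subset> \<sigma>" "card \<tau> = k + 1"
  shows "\<tau> \<in> simplexes X k"
proof -
  have "\<tau> \<noteq> {}" using assms(4) by auto
  then show ?thesis
    using assms unfolding simplicial_complex_def simplexes_def by blast
qed

lemma card_facets:
  assumes X: "simplicial_complex X" and \<sigma>: "\<sigma> \<in> simplexes X (k + 1)"
  shows "card {\<tau> \<in> simplexes X k. \<tau> \<subset> \<sigma>} = k + 2"
proof -
  have "{\<tau> \<in> simplexes X k. \<tau> \<subset> \<sigma>} = {\<tau>. \<tau> \<subseteq> \<sigma> \<and> card \<tau> = k + 1}"
  proof (intro subset_antisym subsetI)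
    fix \<tau> assume "\<tau> \<in> {\<tau>. \<tau> \<subseteq> \<sigma> \<and> card \<tau> = k + 1}"
    moreover have "card \<sigma> = k + 2" using \<sigma> by (simp add: simplexes_def)
    ultimately have "\<tau> \<subset> \<sigma>" "card \<tau> = k + 1" by auto
    then show "\<tau> \<in> {\<tau> \<in> simplexes X k. \<tau> \<subset> \<sigma>}"
      using face_simplexes[OF X \<sigma>] by simp
  qed (auto simp: simplexes_def)
  then have "card {\<tau> \<in> simplexes X k. \<tau> \<subset> \<sigma>} = card \<sigma> choose (k + 1)"
    using n_subsets[OF simplexes_finite(4)[OF X \<sigma>]] by simp
  also have "\<dots> = k + 2"
    using \<sigma> by (simp add: simplexes_def)
  finally show ?thesis .
qed

lemma sq_euclidean_norm_chain:
  assumes X: "simplicial_complex X" and f: "f \<in> simplicial_chains X k"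
  shows "(euclidean_norm X f)\<^sup>2 = (\<Sum>\<sigma>\<in>simplexes X k. (f (reference_order \<sigma>))\<^sup>2)"
proof -
  have "f (reference_order \<sigma>) = 0" if "\<sigma> \<in> X - simplexes X k" for \<sigma>
    using that chain_eq_0[OF f] reference_order[OF simplexes_finite(3)[OF X], of \<sigma>] by simp
  then have "(\<Sum>\<sigma>\<in>X. (f (reference_order \<sigma>))\<^sup>2) = (\<Sum>\<sigma>\<in>simplexes X k. (f (reference_order \<sigma>))\<^sup>2)"
    by (intro sum.mono_neutral_right) (use simplexes_finite(1)[OF X] in \<open>auto simp: simplexes_def\<close>)
  then show ?thesis
    by (simp add: euclidean_norm_def L2_set_def sum_nonneg)
qed

lemma sq_euclidean_norm_boundary:
  assumes X: "simplicial_complex X" and f: "f \<in> simplicial_chains X (k + 1)"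
  shows "(euclidean_norm X (boundary X f))\<^sup>2
    = (\<Sum>\<tau>\<in>simplexes X k. (boundary X f (reference_order \<tau>))\<^sup>2)"
proof -
  have "boundary X f (reference_order \<sigma>) = 0" if "\<sigma> \<in> X - simplexes X k" for \<sigma>
  proof (rule boundary_eq_0[OF X f])
    have "distinct (reference_order \<sigma>)" "set (reference_order \<sigma>) = \<sigma>"
      using that reference_order[OF simplexes_finite(3)[OF X]] by blast+
    then show "\<not> (distinct (reference_order \<sigma>) \<and> length (reference_order \<sigma>) = k + 1)"
      using that distinct_card[of "reference_order \<sigma>"] by (auto simp: simplexes_def)
  qed
  then have "(\<Sum>\<sigma>\<in>X. (boundary X f (reference_order \<sigma>))\<^sup>2)
      = (\<Sum>\<tau>\<in>simplexes X k. (boundary X f (reference_order \<tau>))\<^sup>2)"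
    by (intro sum.mono_neutral_right) (use simplexes_finite(1)[OF X] in \<open>auto simp: simplexes_def\<close>)
  then show ?thesis
    by (simp add: euclidean_norm_def L2_set_def sum_nonneg)
qed

lemma simplexes_of_chain:
  assumes X: "simplicial_complex X" and \<phi>: "\<phi> \<in> simplicial_chains X k"
  shows "simplexes_of \<phi> = {\<sigma> \<in> simplexes X k. \<phi> (reference_order \<sigma>) = 1}"
proof (intro subset_antisym subsetI)
  fix \<sigma> assume "\<sigma> \<in> simplexes_of \<phi>"
  then obtain xs where xs: "\<sigma> = set xs" "\<phi> xs = 1" by (auto simp: simplexes_of_def)
  then have *: "distinct xs" "set xs \<in> simplexes X k"
    using chain_eq_0[OF \<phi>, of xs] by auto
  then have "\<phi> (reference_order (set xs)) \<noteq> 0"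
    using chain_eq_0_reorder[OF \<phi> *(1), of "reference_order (set xs)"] reference_order[of "set xs"] xs
    by simp
  then show "\<sigma> \<in> {\<sigma> \<in> simplexes X k. \<phi> (reference_order \<sigma>) = 1}"
    using * xs by simp
next
  fix \<sigma> assume "\<sigma> \<in> {\<sigma> \<in> simplexes X k. \<phi> (reference_order \<sigma>) = 1}"
  then show "\<sigma> \<in> simplexes_of \<phi>"
    using reference_order_simplexes(2)[OF X, of \<sigma> k] unfolding simplexes_of_def by force
qed

lemma sum_bit_eq_1_iff:
  assumes "finite A"
  shows "(\<Sum>a\<in>A. g a) = (1 :: bit) \<longleftrightarrow> odd (card {a \<in> A. g a = 1})"
  using assms
proof (induction A)
  case (insert a A)
  have "{b \<in> insert a A. g b = 1} = (if g a = 1 then insert a {b \<in> A. g b = 1} else {b \<in> A. g b = 1})"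
    by auto
  then show ?case
    using insert by (cases "g a"; cases "(\<Sum>a\<in>A. g a)") auto
qed simp

text \<open>
  Over the two-element field all incidence coefficients are \<open>1\<close>, so a face survives in the
  boundary exactly when it lies in an odd number of simplexes of the chain.
\<close>

lemma simplexes_of_boundary:
  assumes X: "simplicial_complex X" and \<phi>: "\<phi> \<in> simplicial_chains X (k + 1)"
  shows "simplexes_of (boundary X \<phi>)
    = {\<tau> \<in> simplexes X k. odd (card {\<sigma> \<in> simplexes_of \<phi>. \<tau> \<subset> \<sigma>})}"
proof -
  have coeff: "boundary X \<phi> ys = 1 \<longleftrightarrow> odd (card {\<sigma> \<in> simplexes_of \<phi>. set ys \<subset> \<sigma>})"
    if ys: "distinct ys" "length ys = k + 1" for ys
  proof -
    let ?C = "{\<sigma> \<in> simplexes X (k + 1). set ys \<subset> \<sigma>}"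
    have "boundary X \<phi> ys = (\<Sum>\<sigma>\<in>?C. \<phi> (reference_order \<sigma>))"
      unfolding boundary_eq_sum_cofaces[OF X \<phi> ys]
      using incidence_unit[OF X _ ys, where ?'f = bit] by (intro sum.cong) auto
    then show ?thesis
      using sum_bit_eq_1_iff[of ?C "\<lambda>\<sigma>. \<phi> (reference_order \<sigma>)"] simplexes_finite(2)[OF X, of "k + 1"]
      by (simp add: simplexes_of_chain[OF X \<phi>] conj_ac)
  qed
  show ?thesis
  proof (intro subset_antisym subsetI)
    fix \<tau> assume "\<tau> \<in> simplexes_of (boundary X \<phi>)"
    then obtain ys where ys: "\<tau> = set ys" "boundary X \<phi> ys = 1" by (auto simp: simplexes_of_def)
    then have d: "distinct ys" "length ys = k + 1"
      using boundary_eq_0[OF X \<phi>, of ys] by auto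
    \<comment> \<open>a coefficient \<open>1\<close> forces a coface, which puts the vertex set of \<open>ys\<close> into the complex\<close>
    then have odd: "odd (card {\<sigma> \<in> simplexes_of \<phi>. \<tau> \<subset> \<sigma>})"
      using coeff ys by simp
    then have "{\<sigma> \<in> simplexes_of \<phi>. \<tau> \<subset> \<sigma>} \<noteq> {}"
      by (metis card.empty even_zero)
    then obtain \<sigma> where "\<sigma> \<in> simplexes X (k + 1)" "\<tau> \<subset> \<sigma>"
      using simplexes_of_chain[OF X \<phi>] by blast
    then have "\<tau> \<in> simplexes X k"
      using face_simplexes[OF X] ys(1) d distinct_card[OF d(1)] by simp
    then show "\<tau> \<in> {\<tau> \<in> simplexes X k. odd (card {\<sigma> \<in> simplexes_of \<phi>. \<tau> \<subset> \<sigma>})}"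
      using odd by simp
  next
    fix \<tau> assume \<tau>: "\<tau> \<in> {\<tau> \<in> simplexes X k. odd (card {\<sigma> \<in> simplexes_of \<phi>. \<tau> \<subset> \<sigma>})}"
    then have ref: "distinct (reference_order \<tau>)" "set (reference_order \<tau>) = \<tau>"
      "length (reference_order \<tau>) = k + 1"
      using reference_order_simplexes[OF X, of \<tau> k] by auto
    then have "boundary X \<phi> (reference_order \<tau>) = 1"
      using coeff \<tau> by simp
    then show "\<tau> \<in> simplexes_of (boundary X \<phi>)"
      using ref(2) unfolding simplexes_of_def by blast
  qed
qed

lemma simplicial_chains_empty:
  assumes "simplexes X k = {}"
  shows "simplicial_chains X k = {\<lambda>_. 0}"
  using assms by (auto simp: simplicial_chains_def)

text \<open>
  In top dimension there are no boundaries to divide out: both quotients compare a chain with its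
  own norm.
\<close>

lemma boundaries_top:
  assumes "simplicial_m_complex X m"
  shows "boundaries X m = {\<lambda>_. 0 :: 'f::field}"
  using assms simplicial_chains_empty[of X "m + 1", where ?'b = 'f]
  by (simp add: boundaries_def simplicial_m_complex_def boundary_def)

text \<open>
  This makes the minimum that defines the Cheeger number one over a finite set, as \<^const>\<open>Min\<close>
  requires.
\<close>

lemma finite_simplicial_chains_bit:
  assumes X: "simplicial_complex X"
  shows "finite (simplicial_chains X k :: ('a list \<Rightarrow> bit) set)"
proof -
  let ?D = "{xs. distinct xs \<and> set xs \<in> simplexes X k}"
  have "?D \<subseteq> {xs. set xs \<subseteq> \<Union>X \<and> length xs \<le> k + 1}"
    using distinct_card by (fastforce simp: simplexes_def)
  moreover have "finite (\<Union>X)"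
    using X by (auto simp: simplicial_complex_def)
  ultimately have "finite ?D"
    using finite_lists_length_le finite_subset by blast
  then have "finite ((\<lambda>D xs. of_bool (xs \<in> D) :: bit) ` Pow ?D)"
    by simp
  moreover have "simplicial_chains X k \<subseteq> (\<lambda>D xs. of_bool (xs \<in> D) :: bit) ` Pow ?D"
  proof
    fix \<phi> :: "'a list \<Rightarrow> bit" assume \<phi>: "\<phi> \<in> simplicial_chains X k"
    have "\<phi> = (\<lambda>xs. of_bool (xs \<in> {xs. \<phi> xs = 1}))"
    proof
      fix xs show "\<phi> xs = of_bool (xs \<in> {xs. \<phi> xs = 1})" by (cases "\<phi> xs") auto
    qed
    moreover have "{xs. \<phi> xs = 1} \<in> Pow ?D"
      using chain_eq_0[OF \<phi>] by force
    ultimately show "\<phi> \<in> (\<lambda>D xs. of_bool (xs \<in> D) :: bit) ` Pow ?D" by blast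
  qed
  ultimately show ?thesis by (rule finite_subset[rotated])
qed

lemma cheeger_quotient_top:
  assumes "simplicial_m_complex X m"
  shows "cheeger_quotient X m \<phi> = real (hamming_norm (boundary X \<phi>)) / real (hamming_norm \<phi>)"
  by (simp add: cheeger_quotient_def boundaries_top[OF assms] del: add_bit_eq_xor)

lemma rayleigh_quotient_top:
  assumes "simplicial_m_complex X m"
  shows "rayleigh_quotient X m f = (euclidean_norm X (boundary X f))\<^sup>2 / (euclidean_norm X f)\<^sup>2"
  by (simp add: rayleigh_quotient_def boundaries_top[OF assms])

section \<open>A weighted Cheeger inequality for incidences of size at most two\<close>

lemma card_le_2_cases:
  assumes "finite C" "card C \<le> 2"
  obtains "C = {}" | a where "C = {a}" | a b where "a \<noteq> b" "C = {a, b}"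
proof -
  consider "card C = 0" | "card C = 1" | "card C = 2"
    using assms(2) by linarith
  then show ?thesis
  proof cases
    case 1
    then show ?thesis using assms(1) that(1) by simp
  next
    case 2
    then show ?thesis using that(2) by (metis card_1_singletonE)
  next
    case 3
    then show ?thesis using that(3) by (metis card_2_iff)
  qed
qed

text \<open>
  A face with a single coface is treated as if it had a second coface of weight \<open>0\<close>; so the
  variation of an indicator function is \<open>1\<close> exactly on the boundary of the set.
\<close>

definition coface_variation :: "('s \<Rightarrow> real) \<Rightarrow> 's set \<Rightarrow> real" where
  "coface_variation w C = (if card C = 2 then Max (w ` C) - Min (w ` C) else sum w C)"

lemma coface_variation_simps [simp]:
  "coface_variation w {} = 0"
  "coface_variation w {a} = w a"
  "a \<noteq> b \<Longrightarrow> coface_variation w {a, b} = \<bar>w a - w b\<bar>"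
  by (auto simp: coface_variation_def)

text \<open>
  A discrete coarea formula: lowering a weight by its least positive value \<open>a\<close> on its support
  \<open>A\<close> lowers the total variation by \<open>a\<close> times the size of the boundary of \<open>A\<close>, and the total
  weight by \<open>a * card A\<close>.  So the isoperimetric inequality for sets extends to weights layer by
  layer.
\<close>

lemma isoperimetric_weights:
  fixes w :: "'s \<Rightarrow> real" and C :: "'e \<Rightarrow> 's set"
  assumes S: "finite S" and E: "finite E"
    and C: "\<And>e. e \<in> E \<Longrightarrow> C e \<subseteq> S" "\<And>e. e \<in> E \<Longrightarrow> card (C e) \<le> 2"
    and iso: "\<And>A. A \<subseteq> S \<Longrightarrow> A \<noteq> {} \<Longrightarrow> h * real (card A) \<le> real (card {e \<in> E. odd (card (C e \<inter> A))})"
    and w: "\<And>s. s \<in> S \<Longrightarrow> 0 \<le> w s"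
  shows "h * sum w S \<le> (\<Sum>e\<in>E. coface_variation w (C e))"
  using w
proof (induction "card {s \<in> S. 0 < w s}" arbitrary: w rule: less_induct)
  case less
  define A where "A = {s \<in> S. 0 < w s}"
  have A: "A \<subseteq> S" "finite A" using S by (auto simp: A_def)
  have outside: "w s = 0" if "s \<in> S" "s \<notin> A" for s
    using that less.prems[of s] by (force simp: A_def)
  show ?case
  proof (cases "A = {}")
    case True
    then have "w s = 0" if "s \<in> S" for s using outside that by simp
    moreover have "coface_variation w (C e) = 0" if "e \<in> E" for e
      using finite_subset[OF C(1)[OF that] S] C(2)[OF that]
      by (cases rule: card_le_2_cases) (use C(1)[OF that] calculation in auto)
    ultimately show ?thesis by simp
  next
    case False
    define a where "a = Min (w ` A)"
    define w' where "w' s = (if s \<in> A then w s - a else 0)" for s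
    have a_le: "a \<le> w s" if "s \<in> A" for s
      using A that by (simp add: a_def)
    have "a \<in> w ` A"
      unfolding a_def using A False by (intro Min_in) auto
    then obtain s0 where s0: "s0 \<in> A" "w s0 = a" by auto
    have "0 < a" using s0 by (auto simp: A_def)
    have "{s \<in> S. 0 < w' s} \<subset> A"
      using s0 by (auto simp: w'_def)
    then have "card {s \<in> S. 0 < w' s} < card {s \<in> S. 0 < w s}"
      using A(2) psubset_card_mono unfolding A_def by blast
    moreover have "0 \<le> w' s" for s using a_le by (simp add: w'_def)
    ultimately have IH: "h * sum w' S \<le> (\<Sum>e\<in>E. coface_variation w' (C e))"
      by (rule less.hyps)
    have w_eq: "w s = w' s + a * of_bool (s \<in> A)" if "s \<in> S" for s
      using outside[OF that] by (simp add: w'_def)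
    have "sum w S = (\<Sum>s\<in>S. w' s + a * of_bool (s \<in> A))"
      using w_eq by simp
    also have "\<dots> = sum w' S + a * real (card A)"
      using S A(1) by (simp add: sum.distrib Int_absorb1 flip: sum_distrib_left)
    finally have sum_eq: "sum w S = sum w' S + a * real (card A)" .
    have "coface_variation w (C e) = coface_variation w' (C e) + a * of_bool (odd (card (C e \<inter> A)))"
      if e: "e \<in> E" for e
      using finite_subset[OF C(1)[OF e] S] C(2)[OF e]
    proof (cases rule: card_le_2_cases)
      case (2 x)
      then have "x \<in> S" using C(1)[OF e] by auto
      then show ?thesis using 2 w_eq[of x] by (cases "x \<in> A") auto
    next
      case (3 x y)
      then have "x \<in> S" "y \<in> S" using C(1)[OF e] by auto
      moreover have "card ({x, y} \<inter> A) = of_bool (x \<in> A) + of_bool (y \<in> A)"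
        using 3(1) by (cases "x \<in> A"; cases "y \<in> A") auto
      moreover have "0 \<le> w' x" "0 \<le> w' y" "x \<notin> A \<Longrightarrow> w' x = 0" "y \<notin> A \<Longrightarrow> w' y = 0"
        using a_le by (auto simp: w'_def)
      ultimately show ?thesis
        using 3 w_eq[of x] w_eq[of y] \<open>0 < a\<close> by (cases "x \<in> A"; cases "y \<in> A") simp_all
    qed auto
    then have "(\<Sum>e\<in>E. coface_variation w (C e))
        = (\<Sum>e\<in>E. coface_variation w' (C e) + a * of_bool (odd (card (C e \<inter> A))))"
      by simp
    also have "\<dots> = (\<Sum>e\<in>E. coface_variation w' (C e)) + a * real (card {e \<in> E. odd (card (C e \<inter> A))})"
      using E by (simp add: sum.distrib Int_def flip: sum_distrib_left)
    finally have "(\<Sum>e\<in>E. coface_variation w (C e))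
        = (\<Sum>e\<in>E. coface_variation w' (C e)) + a * real (card {e \<in> E. odd (card (C e \<inter> A))})" .
    moreover have "a * (h * real (card A)) \<le> a * real (card {e \<in> E. odd (card (C e \<inter> A))})"
      using iso[OF A(1) False] \<open>0 < a\<close> by (intro mult_left_mono) auto
    ultimately show ?thesis
      using IH sum_eq by (simp add: algebra_simps)
  qed
qed

text \<open>
  Apply the previous inequality to the weight \<open>g\<^sup>2\<close>.  As \<open>\<bar>a\<^sup>2 - b\<^sup>2\<bar> = \<bar>a - b\<bar> * (a + b)\<close>, the
  Cauchy-Schwarz inequality bounds the square of its variation by \<open>\<Sum> D\<^sup>2\<close> times
  \<open>\<Sum> (a + b)\<^sup>2 \<le> 2 * \<Sum> (a\<^sup>2 + b\<^sup>2)\<close>, and the last sum counts each \<open>(g s)\<^sup>2\<close> once for each of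
  the \<open>d\<close> faces of \<open>s\<close>.
\<close>

lemma weighted_cheeger_inequality:
  fixes g :: "'s \<Rightarrow> real" and D :: "'e \<Rightarrow> real" and C :: "'e \<Rightarrow> 's set"
  assumes S: "finite S" and E: "finite E"
    and C: "\<And>e. e \<in> E \<Longrightarrow> C e \<subseteq> S" "\<And>e. e \<in> E \<Longrightarrow> card (C e) \<le> 2"
    and iso: "\<And>A. A \<subseteq> S \<Longrightarrow> A \<noteq> {} \<Longrightarrow> h * real (card A) \<le> real (card {e \<in> E. odd (card (C e \<inter> A))})"
    and h: "0 \<le> h"
    and degree: "\<And>s. s \<in> S \<Longrightarrow> card {e \<in> E. s \<in> C e} = d"
    and D: "\<And>e. e \<in> E \<Longrightarrow> coface_variation (\<lambda>s. \<bar>g s\<bar>) (C e) \<le> \<bar>D e\<bar>"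
  shows "h\<^sup>2 * (\<Sum>s\<in>S. (g s)\<^sup>2) \<le> 2 * real d * (\<Sum>e\<in>E. (D e)\<^sup>2)"
proof -
  let ?G = "\<Sum>s\<in>S. (g s)\<^sup>2"
  define u where "u e = (\<Sum>s\<in>C e. \<bar>g s\<bar>)" for e
  have var_le: "coface_variation (\<lambda>s. (g s)\<^sup>2) (C e) \<le> \<bar>D e\<bar> * \<bar>u e\<bar>" if e: "e \<in> E" for e
    using finite_subset[OF C(1)[OF e] S] C(2)[OF e]
  proof (cases rule: card_le_2_cases)
    case (2 a)
    then have "\<bar>g a\<bar> * \<bar>g a\<bar> \<le> \<bar>D e\<bar> * \<bar>g a\<bar>"
      using D[OF e] by (intro mult_right_mono) auto
    then show ?thesis using 2 by (simp add: u_def power2_eq_square)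
  next
    case (3 a b)
    have "\<bar>(g a)\<^sup>2 - (g b)\<^sup>2\<bar> = \<bar>(\<bar>g a\<bar> - \<bar>g b\<bar>) * (\<bar>g a\<bar> + \<bar>g b\<bar>)\<bar>"
      by (simp add: algebra_simps power2_eq_square)
    also have "\<dots> = \<bar>\<bar>g a\<bar> - \<bar>g b\<bar>\<bar> * \<bar>\<bar>g a\<bar> + \<bar>g b\<bar>\<bar>"
      by (rule abs_mult)
    also have "\<dots> \<le> \<bar>D e\<bar> * \<bar>\<bar>g a\<bar> + \<bar>g b\<bar>\<bar>"
      using D[OF e] 3 by (intro mult_right_mono) auto
    finally show ?thesis using 3 by (simp add: u_def)
  qed auto
  have u_le: "(u e)\<^sup>2 \<le> 2 * (\<Sum>s\<in>C e. (g s)\<^sup>2)" if e: "e \<in> E" for e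
    using finite_subset[OF C(1)[OF e] S] C(2)[OF e]
  proof (cases rule: card_le_2_cases)
    case (3 a b)
    then show ?thesis
      using sum_squares_ge_zero[of "\<bar>g a\<bar> - \<bar>g b\<bar>" 0] by (simp add: u_def power2_eq_square algebra_simps)
  qed (auto simp: u_def)
  have "(\<Sum>e\<in>E. \<Sum>s\<in>C e. (g s)\<^sup>2) = (\<Sum>e\<in>E. \<Sum>s\<in>{s \<in> S. s \<in> C e}. (g s)\<^sup>2)"
    using C(1) by (intro sum.cong refl) auto
  also have "\<dots> = (\<Sum>s\<in>S. \<Sum>e\<in>{e \<in> E. s \<in> C e}. (g s)\<^sup>2)"
    using E S by (rule sum.swap_restrict)
  also have "\<dots> = real d * ?G"
    using degree by (simp add: sum_distrib_left)
  finally have count: "(\<Sum>e\<in>E. \<Sum>s\<in>C e. (g s)\<^sup>2) = real d * ?G" .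
  have "(\<Sum>e\<in>E. (u e)\<^sup>2) \<le> (\<Sum>e\<in>E. 2 * (\<Sum>s\<in>C e. (g s)\<^sup>2))"
    by (intro sum_mono u_le)
  also have "\<dots> = 2 * real d * ?G"
    using count by (simp flip: sum_distrib_left)
  finally have u_sum: "(\<Sum>e\<in>E. (u e)\<^sup>2) \<le> 2 * real d * ?G" .
  have "h * ?G \<le> (\<Sum>e\<in>E. coface_variation (\<lambda>s. (g s)\<^sup>2) (C e))"
    using S E C iso by (intro isoperimetric_weights) auto
  also have "\<dots> \<le> (\<Sum>e\<in>E. \<bar>D e\<bar> * \<bar>u e\<bar>)"
    by (intro sum_mono var_le)
  also have "\<dots> \<le> L2_set D E * L2_set u E"
    by (rule L2_set_mult_ineq)
  finally have "(h * ?G)\<^sup>2 \<le> (L2_set D E * L2_set u E)\<^sup>2"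
    using h by (intro power_mono) (auto intro!: mult_nonneg_nonneg sum_nonneg)
  also have "\<dots> = (\<Sum>e\<in>E. (D e)\<^sup>2) * (\<Sum>e\<in>E. (u e)\<^sup>2)"
    by (simp add: power_mult_distrib L2_set_def sum_nonneg)
  also have "\<dots> \<le> (\<Sum>e\<in>E. (D e)\<^sup>2) * (2 * real d * ?G)"
    by (intro mult_left_mono u_sum sum_nonneg) auto
  finally have *: "(h\<^sup>2 * ?G) * ?G \<le> (2 * real d * (\<Sum>e\<in>E. (D e)\<^sup>2)) * ?G"
    by (simp add: power2_eq_square algebra_simps)
  \<comment> \<open>cancel one factor \<open>\<Sum> g\<^sup>2\<close>, which may vanish\<close>
  show ?thesis
  proof (cases "?G = 0")
    case True
    then show ?thesis by (simp only: True) (simp add: sum_nonneg)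
  next
    case False
    then have "0 < ?G" by (simp add: order.not_eq_order_implies_strict sum_nonneg)
    then show ?thesis using * by (rule mult_right_le_imp_le[rotated])
  qed
qed

section \<open>The upper bound for the spectral gap\<close>

lemma oriented_simplex_chain:
  assumes "distinct xs" "set xs \<in> simplexes X k"
  shows "oriented_simplex xs \<in> (simplicial_chains X k :: ('a list \<Rightarrow> 'f::field) set)"
  unfolding simplicial_chains_def
proof (intro CollectI conjI allI impI)
  fix ys assume "oriented_simplex xs ys \<noteq> (0 :: 'f)"
  then have "distinct ys \<and> set ys = set xs"
    using oriented_simplex_eq_0[OF assms(1)] by blast
  then show "distinct ys" "set ys \<in> simplexes X k" using assms(2) by auto
qed (rule oriented_simplex_alternating)

lemma sum_chain:
  fixes c :: "'b \<Rightarrow> 'a list \<Rightarrow> 'f::field"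
  assumes "\<And>a. a \<in> A \<Longrightarrow> c a \<in> simplicial_chains X k"
  shows "(\<lambda>xs. \<Sum>a\<in>A. c a xs) \<in> simplicial_chains X k"
  unfolding simplicial_chains_def
proof (intro CollectI conjI allI impI)
  fix xs assume "(\<Sum>a\<in>A. c a xs) \<noteq> 0"
  then obtain a where "a \<in> A" "c a xs \<noteq> 0" by (meson sum.neutral)
  then show "distinct xs" "set xs \<in> simplexes X k"
    using chain_eq_0[OF assms] by blast+
next
  fix xs :: "'a list" and p assume "p permutes {..<length xs}"
  then show "(\<Sum>a\<in>A. c a (permute_list p xs)) = of_int (sign p) * (\<Sum>a\<in>A. c a xs)"
    by (simp add: chain_alternating[OF assms] sum_distrib_left)
qed

lemma boundary_sum:
  "boundary X (\<lambda>xs. \<Sum>a\<in>A. c a xs) ys = (\<Sum>a\<in>A. boundary X (c a) ys)"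
  unfolding boundary_def by (simp add: sum_distrib_right sum.swap[of _ A])

lemma boundary_oriented_simplex:
  assumes X: "simplicial_complex X" and xs: "distinct xs" "set xs \<in> simplexes X (k + 1)"
    and ys: "distinct ys" "length ys = k + 1"
  shows "set ys \<subset> set xs \<Longrightarrow> boundary X (oriented_simplex xs) ys \<in> {1, - 1 :: 'f::field}"
    and "\<not> set ys \<subset> set xs \<Longrightarrow> boundary X (oriented_simplex xs) ys = (0 :: 'f)"
proof -
  let ?r = reference_order
  note ref = reference_order_simplexes[OF X]
  have other: "oriented_simplex xs (?r \<sigma>) = (0 :: 'f)" if "\<sigma> \<in> simplexes X (k + 1)" "\<sigma> \<noteq> set xs" for \<sigma>
    using ref(2)[OF that(1)] that(2) by (intro oriented_simplex_eq_0 xs(1)) simp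
  have "boundary X (oriented_simplex xs) ys
      = (\<Sum>\<sigma>\<in>{\<sigma> \<in> simplexes X (k + 1). set ys \<subset> \<sigma>}. oriented_simplex xs (?r \<sigma>) * boundary_simplex (?r \<sigma>) ys :: 'f)"
    by (rule boundary_eq_sum_cofaces[OF X oriented_simplex_chain[OF xs] ys])
  also have "\<dots> = (\<Sum>\<sigma>\<in>{\<sigma> \<in> {set xs}. set ys \<subset> \<sigma>}. oriented_simplex xs (?r \<sigma>) * boundary_simplex (?r \<sigma>) ys)"
    using xs(2) other simplexes_finite(2)[OF X, of "k + 1"] by (intro sum.mono_neutral_right) auto
  also have "{\<sigma> \<in> {set xs}. set ys \<subset> \<sigma>} = (if set ys \<subset> set xs then {set xs} else {})"
    by auto
  finally have eq: "boundary X (oriented_simplex xs) ys = (if set ys \<subset> set xs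
      then oriented_simplex xs (?r (set xs)) * boundary_simplex (?r (set xs)) ys else 0 :: 'f)"
    by simp
  show "boundary X (oriented_simplex xs) ys = (0 :: 'f)" if "\<not> set ys \<subset> set xs"
    using eq that by simp
  show "boundary X (oriented_simplex xs) ys \<in> {1, - 1 :: 'f}" if sub: "set ys \<subset> set xs"
  proof -
    have "xs \<noteq> []" using sub by auto
    then have "oriented_simplex xs (?r (set xs)) \<in> {1, - 1 :: 'f}"
      using ref[OF xs(2)] by (intro oriented_simplex_unit xs) auto
    moreover have "boundary_simplex (?r (set xs)) ys \<in> {1, - 1 :: 'f}"
      using incidence_unit[OF X xs(2) ys sub] .
    ultimately show ?thesis using eq sub by auto
  qed
qed

text \<open>
  There are only two units, so at most two pairwise different ones can be summed, and two of
  them cancel.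
\<close>

lemma sum_distinct_units:
  fixes b :: "'s \<Rightarrow> real"
  assumes "inj_on b C" "b ` C \<subseteq> {1, - 1}"
  shows "(sum b C)\<^sup>2 = of_bool (odd (card C))"
proof -
  have "sum b C = \<Sum> (b ` C)"
    by (rule sum.reindex_cong[OF assms(1) refl refl, symmetric])
  moreover have "card C = card (b ` C)"
    using card_image[OF assms(1)] by (rule sym)
  moreover have "b ` C \<in> {{}, {1}, {- 1}, {1, - 1}}"
  proof -
    have "b ` C \<in> Pow {1, - 1}" using assms(2) by (rule PowI)
    also have "Pow {1, - 1 :: real} = {{}, {1}, {- 1}, {1, - 1}}"
      by (auto simp only: Pow_insert Pow_empty image_insert image_empty)
    finally show ?thesis .
  qed
  ultimately show ?thesis by fastforce
qed

text \<open>
  Similar orientations make the integral boundary of the sum of the simplexes of \<open>A\<close> as small as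
  the boundary modulo 2: at a face the simplexes of \<open>A\<close> contribute pairwise different units, so
  a nonzero coefficient is a unit and occurs exactly at the faces of odd incidence.
\<close>

lemma similarly_oriented_real_chain:
  fixes X :: "'a set set"
  assumes X: "simplicial_complex X" and A: "A \<subseteq> simplexes X (k + 1)"
    and orient: "can_be_similarly_oriented X A"
  obtains f :: "'a list \<Rightarrow> real" where "f \<in> simplicial_chains X (k + 1)"
    and "(euclidean_norm X f)\<^sup>2 = real (card A)"
    and "(euclidean_norm X (boundary X f))\<^sup>2 = real (card {\<tau> \<in> simplexes X k. odd (card {\<sigma> \<in> A. \<tau> \<subset> \<sigma>})})"
proof -
  obtain ord where orient': "\<forall>\<sigma>\<in>A. distinct (ord \<sigma>) \<and> set (ord \<sigma>) = \<sigma>"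
    and similar: "\<forall>\<sigma>\<in>A. \<forall>\<tau>\<in>A. lower_adjacent X \<sigma> \<tau> \<longrightarrow> \<not> dissimilarly_oriented X (ord \<sigma>) (ord \<tau>)"
    using orient unfolding can_be_similarly_oriented_def by (elim exE conjE)
  have ord: "distinct (ord \<sigma>)" "set (ord \<sigma>) = \<sigma>" if "\<sigma> \<in> A" for \<sigma>
    using orient' that by auto
  have finA: "finite A"
    using A simplexes_finite(2)[OF X] by (rule finite_subset)
  note ref = reference_order_simplexes[OF X]
  define f :: "'a list \<Rightarrow> real" where "f = (\<lambda>xs. \<Sum>\<sigma>\<in>A. oriented_simplex (ord \<sigma>) xs)"
  have set_ord: "set (ord \<sigma>) \<in> simplexes X (k + 1)" if "\<sigma> \<in> A" for \<sigma>
    using that ord(2) A by auto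
  have f: "f \<in> simplicial_chains X (k + 1)"
    unfolding f_def by (intro sum_chain oriented_simplex_chain ord(1) set_ord)
  have coeff: "(f (reference_order \<sigma>))\<^sup>2 = of_bool (\<sigma> \<in> A)" if \<sigma>: "\<sigma> \<in> simplexes X (k + 1)" for \<sigma>
  proof -
    have "oriented_simplex (ord \<tau>) (reference_order \<sigma>) = (0 :: real)" if "\<tau> \<in> A" "\<tau> \<noteq> \<sigma>" for \<tau>
      using ord(2)[OF that(1)] ref(2)[OF \<sigma>] that by (intro oriented_simplex_eq_0 ord(1)) auto
    then have "f (reference_order \<sigma>) = (\<Sum>\<tau>\<in>A \<inter> {\<sigma>}. oriented_simplex (ord \<tau>) (reference_order \<sigma>))"
      unfolding f_def using finA by (intro sum.mono_neutral_right) auto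
    moreover have "oriented_simplex (ord \<sigma>) (reference_order \<sigma>) \<in> {1, - 1 :: real}" if "\<sigma> \<in> A"
    proof (intro oriented_simplex_unit ord(1) that ref(1)[OF \<sigma>])
      show "set (reference_order \<sigma>) = set (ord \<sigma>)" using ord(2)[OF that] ref(2)[OF \<sigma>] by simp
      then show "ord \<sigma> \<noteq> []" using ref(3)[OF \<sigma>] by auto
    qed
    ultimately show ?thesis by (cases "\<sigma> \<in> A") auto
  qed
  have bd_coeff: "(boundary X f (reference_order \<rho>))\<^sup>2 = of_bool (odd (card {\<sigma> \<in> A. \<rho> \<subset> \<sigma>}))"
    if \<rho>: "\<rho> \<in> simplexes X k" for \<rho>
  proof -
    let ?us = "reference_order \<rho>"
    define b :: "'a set \<Rightarrow> real" where "b \<sigma> = boundary X (oriented_simplex (ord \<sigma>)) ?us" for \<sigma>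
    let ?C = "{\<sigma> \<in> A. \<rho> \<subset> \<sigma>}"
    have unit: "b \<sigma> \<in> {1, - 1}" if "\<sigma> \<in> ?C" for \<sigma>
      unfolding b_def using that ord[of \<sigma>] set_ord[of \<sigma>] ref[OF \<rho>]
      by (intro boundary_oriented_simplex(1)[OF X]) auto
    have zero: "b \<sigma> = 0" if "\<sigma> \<in> A - ?C" for \<sigma>
      unfolding b_def using that ord[of \<sigma>] set_ord[of \<sigma>] ref[OF \<rho>]
      by (intro boundary_oriented_simplex(2)[OF X]) auto
    have "inj_on b ?C"
    proof (rule inj_onI, rule ccontr)
      fix \<sigma> \<tau> assume \<sigma>: "\<sigma> \<in> ?C" and \<tau>: "\<tau> \<in> ?C" and eq: "b \<sigma> = b \<tau>" and "\<sigma> \<noteq> \<tau>"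
      have faces: "is_face X \<rho> \<sigma>" "is_face X \<rho> \<tau>"
        using \<sigma> \<tau> \<rho> A unfolding is_face_def by blast+
      then have "\<not> dissimilarly_oriented X (ord \<sigma>) (ord \<tau>)"
        using \<sigma> \<tau> \<open>\<sigma> \<noteq> \<tau>\<close> by (intro similar[rule_format]) (auto simp: lower_adjacent_def)
      moreover have "dissimilarly_oriented X (ord \<sigma>) (ord \<tau>)"
        unfolding dissimilarly_oriented_def using faces eq ref[OF \<rho>] ord(2) \<sigma> \<tau>
        by (intro exI[of _ ?us]) (auto simp: b_def)
      ultimately show False by blast
    qed
    then have "(sum b ?C)\<^sup>2 = of_bool (odd (card ?C))"
      using unit by (intro sum_distinct_units) auto
    moreover have "boundary X f ?us = sum b A"
      by (simp add: f_def b_def boundary_sum)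
    moreover have "sum b A = sum b ?C"
      using finA zero by (intro sum.mono_neutral_right) auto
    ultimately show ?thesis by simp
  qed
  have "(euclidean_norm X f)\<^sup>2 = (\<Sum>\<sigma>\<in>simplexes X (k + 1). of_bool (\<sigma> \<in> A))"
    unfolding sq_euclidean_norm_chain[OF X f] by (intro sum.cong coeff refl)
  also have "\<dots> = real (card A)"
    using simplexes_finite(2)[OF X, of "k + 1"] A by (simp add: Int_absorb1)
  finally have norm: "(euclidean_norm X f)\<^sup>2 = real (card A)" .
  have "(euclidean_norm X (boundary X f))\<^sup>2
      = (\<Sum>\<tau>\<in>simplexes X k. of_bool (odd (card {\<sigma> \<in> A. \<tau> \<subset> \<sigma>})))"
    unfolding sq_euclidean_norm_boundary[OF X f] by (intro sum.cong bd_coeff refl)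
  also have "\<dots> = real (card {\<tau> \<in> simplexes X k. odd (card {\<sigma> \<in> A. \<tau> \<subset> \<sigma>})})"
    using simplexes_finite(2)[OF X, of k] by (simp add: Int_def)
  finally show ?thesis using that f norm by blast
qed

lemma spectral_gap_le_rayleigh_quotient:
  assumes X: "simplicial_m_complex X m" and f: "f \<in> simplicial_chains X m - boundaries X m"
  shows "spectral_gap X m \<le> rayleigh_quotient X m f"
  unfolding spectral_gap_def
proof (rule cINF_lower[OF _ f])
  show "bdd_below (rayleigh_quotient X m ` (simplicial_chains X m - boundaries X m))"
    by (rule bdd_belowI2[of _ 0]) (simp add: rayleigh_quotient_top[OF X])
qed

lemma spectral_gap_le_cheeger_quotient:
  assumes X: "simplicial_m_complex X (k + 1)"
    and \<phi>: "\<phi> \<in> simplicial_chains X (k + 1) - boundaries X (k + 1)"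
    and orient: "can_be_similarly_oriented X (simplexes_of \<phi>)"
  shows "spectral_gap X (k + 1) \<le> cheeger_quotient X (k + 1) \<phi>"
proof -
  have complex: "simplicial_complex X"
    using X by (simp add: simplicial_m_complex_def)
  let ?A = "simplexes_of \<phi>"
  have A: "?A \<subseteq> simplexes X (k + 1)"
    using \<phi> simplexes_of_chain[OF complex] by blast
  obtain f :: "'a list \<Rightarrow> real" where f: "f \<in> simplicial_chains X (k + 1)"
    and norm: "(euclidean_norm X f)\<^sup>2 = real (card ?A)"
    and bd: "(euclidean_norm X (boundary X f))\<^sup>2
      = real (card {\<tau> \<in> simplexes X k. odd (card {\<sigma> \<in> ?A. \<tau> \<subset> \<sigma>})})"
    using similarly_oriented_real_chain[OF complex A orient] by blast
  have "\<exists>xs. \<phi> xs \<noteq> 0"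
    using \<phi> boundaries_top[OF X, where ?'f = bit] by auto
  then have "?A \<noteq> {}"
    unfolding simplexes_of_def by auto
  then have "card ?A \<noteq> 0"
    using finite_subset[OF A simplexes_finite(2)[OF complex]] by simp
  then have "f \<noteq> (\<lambda>_. 0)"
    using norm by (auto simp: euclidean_norm_def L2_set_def)
  then have "spectral_gap X (k + 1) \<le> rayleigh_quotient X (k + 1) f"
    using f boundaries_top[OF X] by (intro spectral_gap_le_rayleigh_quotient[OF X]) auto
  also have "\<dots> = cheeger_quotient X (k + 1) \<phi>"
    unfolding rayleigh_quotient_top[OF X] cheeger_quotient_top[OF X] hamming_norm_def norm bd
    using simplexes_of_boundary[OF complex, of \<phi> k] \<phi> by simp
  finally show ?thesis .
qed

section \<open>The lower bound for the spectral gap\<close>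

lemma cheeger_number_minimum:
  assumes X: "simplicial_m_complex X m"
    and \<phi>: "\<phi> \<in> simplicial_chains X m - boundaries X m"
  shows "cheeger_number X m \<le> cheeger_quotient X m \<phi>"
    and "\<exists>\<psi>\<in>simplicial_chains X m - boundaries X m. cheeger_number X m = cheeger_quotient X m \<psi>"
proof -
  let ?Q = "cheeger_quotient X m ` (simplicial_chains X m - boundaries X m)"
  have fin: "finite ?Q"
    using finite_simplicial_chains_bit[of X m] X by (simp add: simplicial_m_complex_def)
  show "cheeger_number X m \<le> cheeger_quotient X m \<phi>"
    unfolding cheeger_number_def using fin \<phi> by (intro Min_le) auto
  have "cheeger_number X m \<in> ?Q"
    unfolding cheeger_number_def using fin \<phi> by (intro Min_in) auto
  then show "\<exists>\<psi>\<in>simplicial_chains X m - boundaries X m. cheeger_number X m = cheeger_quotient X m \<psi>"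
    by blast
qed

lemma simplex_set_chain:
  assumes "A \<subseteq> simplexes X k"
  defines "\<phi> \<equiv> \<lambda>xs. of_bool (distinct xs \<and> set xs \<in> A) :: bit"
  shows "\<phi> \<in> simplicial_chains X k" and "simplicial_complex X \<Longrightarrow> simplexes_of \<phi> = A"
proof -
  show chain: "\<phi> \<in> simplicial_chains X k"
    unfolding simplicial_chains_def
  proof (intro CollectI conjI allI impI)
    fix xs :: "'a list" and p assume "p permutes {..<length xs}"
    moreover have "of_int (sign p) = (1 :: bit)"
      by (cases p rule: sign_cases) auto
    ultimately show "\<phi> (permute_list p xs) = of_int (sign p) * \<phi> xs"
      by (simp add: \<phi>_def del: mult_bit_eq_and)
  qed (use assms(1) in \<open>auto simp: \<phi>_def\<close>)
  show "simplexes_of \<phi> = A" if X: "simplicial_complex X"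
    using reference_order_simplexes[OF X] assms(1)
    unfolding simplexes_of_chain[OF X chain] by (auto simp: \<phi>_def)
qed

text \<open>
  Every nonempty set of top simplexes is the support of a chain modulo 2 that is not a boundary, so
  the Cheeger number is an isoperimetric constant.
\<close>

lemma cheeger_number_isoperimetric:
  assumes X: "simplicial_m_complex X (k + 1)" and A: "A \<subseteq> simplexes X (k + 1)" "A \<noteq> {}"
  shows "0 \<le> cheeger_number X (k + 1)"
    and "cheeger_number X (k + 1) * real (card A)
      \<le> real (card {\<tau> \<in> simplexes X k. odd (card {\<sigma> \<in> A. \<tau> \<subset> \<sigma>})})"
proof -
  have complex: "simplicial_complex X"
    using X by (simp add: simplicial_m_complex_def)
  define \<phi> where "\<phi> xs = (of_bool (distinct xs \<and> set xs \<in> A) :: bit)" for xs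
  have \<phi>: "\<phi> \<in> simplicial_chains X (k + 1)" "simplexes_of \<phi> = A"
    using simplex_set_chain[OF A(1)] complex unfolding \<phi>_def by auto
  have "\<phi> \<noteq> (\<lambda>_. 0)"
    using \<phi>(2) A(2) by (auto simp: simplexes_of_def)
  then have \<phi>': "\<phi> \<in> simplicial_chains X (k + 1) - boundaries X (k + 1)"
    using \<phi>(1) boundaries_top[OF X] by auto
  show "0 \<le> cheeger_number X (k + 1)"
    using cheeger_number_minimum(2)[OF X \<phi>'] cheeger_quotient_top[OF X] by fastforce
  have "0 < card A"
    using A finite_subset[OF A(1) simplexes_finite(2)[OF complex]] by (simp add: card_gt_0_iff)
  moreover have "cheeger_number X (k + 1)
      \<le> real (card {\<tau> \<in> simplexes X k. odd (card {\<sigma> \<in> A. \<tau> \<subset> \<sigma>})}) / real (card A)"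
    using cheeger_number_minimum(1)[OF X \<phi>'] unfolding cheeger_quotient_top[OF X] hamming_norm_def
      simplexes_of_boundary[OF complex \<phi>(1)] \<phi>(2) .
  ultimately show "cheeger_number X (k + 1) * real (card A)
      \<le> real (card {\<tau> \<in> simplexes X k. odd (card {\<sigma> \<in> A. \<tau> \<subset> \<sigma>})})"
    by (simp add: pos_le_divide_eq)
qed

lemma euclidean_norm_pos:
  assumes X: "simplicial_complex X" and f: "f \<in> simplicial_chains X k" "f \<noteq> (\<lambda>_. 0)"
  shows "0 < (euclidean_norm X f)\<^sup>2"
proof -
  obtain xs where xs: "f xs \<noteq> 0" using f(2) by auto
  then have d: "distinct xs" "set xs \<in> simplexes X k"
    using chain_eq_0[OF f(1)] by blast+
  then have "f (reference_order (set xs)) \<noteq> 0"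
    using chain_eq_0_reorder[OF f(1) d(1)] reference_order_simplexes[OF X d(2)] xs by metis
  then have "0 < (f (reference_order (set xs)))\<^sup>2" by simp
  also have "\<dots> \<le> (\<Sum>\<sigma>\<in>simplexes X k. (f (reference_order \<sigma>))\<^sup>2)"
    using d(2) simplexes_finite(2)[OF X] by (intro member_le_sum) auto
  finally show ?thesis unfolding sq_euclidean_norm_chain[OF X f(1)] .
qed

text \<open>
  Taking absolute values forgets the signs of the incidence coefficients, and
  \<open>\<bar>\<bar>x\<bar> - \<bar>y\<bar>\<bar> \<le> \<bar>x \<plusminus> y\<bar>\<close> covers both ways in which two cofaces can be oriented.
\<close>

lemma coface_variation_le_boundary:
  assumes X: "simplicial_complex X" and f: "f \<in> simplicial_chains X (k + 1)"
    and \<tau>: "\<tau> \<in> simplexes X k"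
    and two: "card {\<sigma> \<in> simplexes X (k + 1). \<tau> \<subset> \<sigma>} \<le> 2"
  shows "coface_variation (\<lambda>\<sigma>. \<bar>f (reference_order \<sigma>)\<bar>) {\<sigma> \<in> simplexes X (k + 1). \<tau> \<subset> \<sigma>}
    \<le> \<bar>boundary X f (reference_order \<tau>)\<bar>"
proof -
  let ?r = reference_order
  let ?C = "{\<sigma> \<in> simplexes X (k + 1). \<tau> \<subset> \<sigma>}"
  note ref = reference_order_simplexes[OF X \<tau>]
  have bd: "boundary X f (?r \<tau>) = (\<Sum>\<sigma>\<in>?C. f (?r \<sigma>) * boundary_simplex (?r \<sigma>) (?r \<tau>))"
    using boundary_eq_sum_cofaces[OF X f ref(1,3)] unfolding ref(2) .
  have unit: "boundary_simplex (?r \<sigma>) (?r \<tau>) \<in> {1, - 1 :: real}" if "\<sigma> \<in> ?C" for \<sigma>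
    using that ref by (intro incidence_unit[OF X]) auto
  have "finite ?C" using simplexes_finite(2)[OF X] by simp
  then show ?thesis
    using two
  proof (cases rule: card_le_2_cases)
    case (2 a)
    then show ?thesis using unit[of a] unfolding bd 2 by auto
  next
    case (3 a b)
    have "a \<in> ?C" "b \<in> ?C" unfolding 3(2) by auto
    then show ?thesis using 3(1) unit[of a] unit[of b] unfolding bd 3(2) by auto
  next
    case 1
    then show ?thesis unfolding 1 by simp
  qed
qed

lemma cheeger_sq_le_rayleigh_quotient:
  assumes X: "simplicial_m_complex X (k + 1)"
    and f: "f \<in> simplicial_chains X (k + 1) - boundaries X (k + 1)"
    and two: "\<And>\<tau>. \<tau> \<in> simplexes X k \<Longrightarrow> card {\<sigma> \<in> simplexes X (k + 1). \<tau> \<subset> \<sigma>} \<le> 2"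
  shows "(cheeger_number X (k + 1))\<^sup>2 / (2 * real (k + 2)) \<le> rayleigh_quotient X (k + 1) f"
proof -
  have complex: "simplicial_complex X" and ne: "simplexes X (k + 1) \<noteq> {}"
    using X by (simp_all add: simplicial_m_complex_def)
  have f': "f \<in> simplicial_chains X (k + 1)" "f \<noteq> (\<lambda>_. 0)"
    using f boundaries_top[OF X] by auto
  have pos: "0 < (euclidean_norm X f)\<^sup>2"
    by (rule euclidean_norm_pos[OF complex f'])
  have "(cheeger_number X (k + 1))\<^sup>2 * (\<Sum>\<sigma>\<in>simplexes X (k + 1). (f (reference_order \<sigma>))\<^sup>2)
      \<le> 2 * real (k + 2) * (\<Sum>\<tau>\<in>simplexes X k. (boundary X f (reference_order \<tau>))\<^sup>2)"
  proof (rule weighted_cheeger_inequality[where C = "\<lambda>\<tau>. {\<sigma> \<in> simplexes X (k + 1). \<tau> \<subset> \<sigma>}"])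
    fix A assume A: "A \<subseteq> simplexes X (k + 1)" "A \<noteq> {}"
    have "{\<sigma> \<in> simplexes X (k + 1). \<tau> \<subset> \<sigma>} \<inter> A = {\<sigma> \<in> A. \<tau> \<subset> \<sigma>}" for \<tau>
      using A(1) by auto
    then show "cheeger_number X (k + 1) * real (card A)
        \<le> real (card {\<tau> \<in> simplexes X k. odd (card ({\<sigma> \<in> simplexes X (k + 1). \<tau> \<subset> \<sigma>} \<inter> A))})"
      using cheeger_number_isoperimetric(2)[OF X A] by simp
  next
    fix \<sigma> assume \<sigma>: "\<sigma> \<in> simplexes X (k + 1)"
    then show "card {\<tau> \<in> simplexes X k. \<sigma> \<in> {\<sigma> \<in> simplexes X (k + 1). \<tau> \<subset> \<sigma>}} = k + 2"
      using card_facets[OF complex \<sigma>] by simp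
  next
    show "0 \<le> cheeger_number X (k + 1)"
      by (rule cheeger_number_isoperimetric(1)[OF X subset_refl ne])
  qed (use complex f'(1) two in \<open>auto simp only: simplexes_finite(2) coface_variation_le_boundary\<close>)
  then have "(cheeger_number X (k + 1))\<^sup>2 * (euclidean_norm X f)\<^sup>2
      \<le> (euclidean_norm X (boundary X f))\<^sup>2 * (2 * real (k + 2))"
    unfolding sq_euclidean_norm_chain[OF complex f'(1)] sq_euclidean_norm_boundary[OF complex f'(1)]
    by (simp only: mult_ac)
  then show ?thesis
    unfolding rayleigh_quotient_top[OF X] using pos
    by (simp add: pos_divide_le_eq pos_le_divide_eq del: of_nat_add)
qed

lemma exists_nonzero_chain:
  fixes X :: "'a set set"
  assumes X: "simplicial_m_complex X m"
  shows "simplicial_chains X m - boundaries X m \<noteq> ({} :: ('a list \<Rightarrow> 'f::field) set)"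
proof -
  have complex: "simplicial_complex X"
    using X by (simp add: simplicial_m_complex_def)
  obtain \<sigma> where \<sigma>: "\<sigma> \<in> simplexes X m"
    using X by (auto simp: simplicial_m_complex_def)
  note ref = reference_order_simplexes[OF complex \<sigma>]
  let ?f = "oriented_simplex (reference_order \<sigma>) :: 'a list \<Rightarrow> 'f"
  have "reference_order \<sigma> \<noteq> []" using ref(3) by auto
  then have "?f (reference_order \<sigma>) \<in> {1, - 1}"
    by (intro oriented_simplex_unit ref(1) refl)
  then have "?f \<noteq> (\<lambda>_. 0)" by auto
  moreover have "?f \<in> simplicial_chains X m"
    using ref \<sigma> by (intro oriented_simplex_chain) auto
  ultimately show ?thesis using boundaries_top[OF X, where ?'f = 'f] by auto
qed

section \<open>Cheeger inequalities in top dimension\<close>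

theorem theorem2p7:
  fixes X :: "'a set set" and m :: nat
  assumes "simplicial_m_complex X m" and "m > 0"
  shows "(\<forall>\<phi>. is_arg_min (cheeger_quotient X m) (\<lambda>\<phi>. \<phi> \<in> simplicial_chains X m \<and> \<phi> \<notin> boundaries X m) \<phi> \<longrightarrow>
            can_be_similarly_oriented X (simplexes_of \<phi>) \<longrightarrow>
            cheeger_number X m \<ge> spectral_gap X m) \<and>
         ((\<forall>\<tau>\<in>simplexes X (m - 1). card {\<sigma> \<in> simplexes X m. \<tau> \<subset> \<sigma>} \<le> 2) \<longrightarrow>
            spectral_gap X m \<ge> (cheeger_number X m)\<^sup>2 / (2 * (real m + 1)))"
proof (intro conjI allI impI)
  obtain k where m: "m = k + 1"
    using \<open>m > 0\<close> by (metis Suc_eq_plus1 gr0_implies_Suc)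
  note X = assms(1)[unfolded m]
  show "spectral_gap X m \<le> cheeger_number X m"
    if min: "is_arg_min (cheeger_quotient X m) (\<lambda>\<phi>. \<phi> \<in> simplicial_chains X m \<and> \<phi> \<notin> boundaries X m) \<phi>"
      and orient: "can_be_similarly_oriented X (simplexes_of \<phi>)" for \<phi>
  proof -
    have \<phi>: "\<phi> \<in> simplicial_chains X m - boundaries X m"
      using min by (simp add: is_arg_min_def)
    obtain \<psi> where "\<psi> \<in> simplicial_chains X m - boundaries X m"
      "cheeger_number X m = cheeger_quotient X m \<psi>"
      using cheeger_number_minimum(2)[OF assms(1) \<phi>] by blast
    then have "cheeger_quotient X m \<phi> \<le> cheeger_number X m"
      using min by (simp add: is_arg_min_linorder)
    then show ?thesis
      using spectral_gap_le_cheeger_quotient[OF X \<phi>[unfolded m] orient] unfolding m by linarith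
  qed
  show "(cheeger_number X m)\<^sup>2 / (2 * (real m + 1)) \<le> spectral_gap X m"
    if two: "\<forall>\<tau>\<in>simplexes X (m - 1). card {\<sigma> \<in> simplexes X m. \<tau> \<subset> \<sigma>} \<le> 2"
    unfolding spectral_gap_def
  proof (rule cINF_greatest[OF exists_nonzero_chain[OF assms(1)]])
    fix f :: "'a list \<Rightarrow> real" assume "f \<in> simplicial_chains X m - boundaries X m"
    then have "(cheeger_number X m)\<^sup>2 / (2 * real (k + 2)) \<le> rayleigh_quotient X m f"
      using cheeger_sq_le_rayleigh_quotient[OF X] two unfolding m by simp
    then show "(cheeger_number X m)\<^sup>2 / (2 * (real m + 1)) \<le> rayleigh_quotient X m f"
      by (simp add: m add_ac)
  qed
qed

end
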